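(* There exists a unique Schürmann triple $(\rho_{10},c,\psi)$ on $so(3,1)$ over $D_{10}$ containing the representation $\rho_{10}$ and the cocycle $c$.
   Context: The Lie algebra $so(3,1)\cong sl(2,\mathbb{C})$ of the Lorentz group is considered through its complexification, which has basis $\{H_1,H_2,H_3,F_1,F_2,F_3\}$ and relations $[H_j,H_k]=i\epsilon_{jk\ell}H_\ell$, $[F_j,F_k]=-i\epsilon_{jk\ell}H_\ell$, $[F_j,H_k]=i\epsilon_{jk\ell}F_\ell$ (summation over $\ell$; $\epsilon_{jk\ell}$ is the Levi-Civita symbol). It carries the involution $*$ (conjugate-linear, $[X,Y]^*=[Y^*,X^*]$) making these six elements hermitian. The real Lie algebra $\mathfrak{g}=so(3,1)$ consists of the anti-hermitian elements $X^*=-X$, i.e. it is the real span of $iH_j,iF_j$. Put $H_\pm=H_1\pm iH_2$ and $F_\pm=F_1\pm iF_2$. Let $D_{10}=\mathrm{span}\{\xi_{\ell m}:\ \ell=1,2,3,\ldots,\ m=-\ell,-\ell+1,\ldots,\ell\}$ be the complex pre-Hilbert space (algebraic linear span) for which the $\xi_{\ell m}$ form an orthonormal system. For $\ell\ge 1$ set $C_\ell=i\sqrt{\frac{\ell^2-1}{4\ell^2-1}}$. The representation $\rho_{10}$ acts on $D_{10}$ by $$\rho_{10}(H_3)\xi_{\ell m}=m\,\xi_{\ell m},\qquad \rho_{10}(H_\pm)\xi_{\ell m}=\sqrt{(\ell\mp m)(\ell\pm m+1)}\,\xi_{\ell,m\pm1},$$ $$\rho_{10}(F_3)\xi_{\ell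 m}=C_\ell\sqrt{\ell^2-m^2}\,\xi_{\ell-1,m}-C_{\ell+1}\sqrt{(\ell+1)^2-m^2}\,\xi_{\ell+1,m},$$ $$\rho_{10}(F_\pm)\xi_{\ell m}=\pm C_\ell\sqrt{(\ell\mp m)(\ell\mp m-1)}\,\xi_{\ell-1,m\pm1}\pm C_{\ell+1}\sqrt{(\ell\pm m+1)(\ell\pm m+2)}\,\xi_{\ell+1,m\pm1},$$ where terms with vanishing coefficient are omitted (in particular $C_1=0$). The cocycle $c$ is the complex-linear map on the complexification $\mathfrak{g}_{\mathbb{C}}$ (restricted to $\mathfrak{g}$) with values in $D_{10}$ given by $c(H_3)=c(H_\pm)=0$, $c(F_3)=-\frac{1}{\sqrt2}\xi_{10}$, $c(F_\pm)=\pm\xi_{1,\pm1}$. For a pre-Hilbert space $D$, $\mathcal{L}_{\rm AH}(D)$ denotes the anti-Hermitian linear operators $D\to D$. A Schürmann triple on a real Lie algebra $\mathfrak{g}$ over $D$ is a triple $(\rho,\eta,\psi)$ where: (a) $\rho:\mathfrak{g}\to\mathcal{L}_{\rm AH}(D)$ is a representation, i.e. $\rho$ is linear with $\rho([X,Y])=\rho(X)\rho(Y)-\rho(Y)\rho(X)$ for $X,Y\in\mathfrak{g}$; (b) $\eta:\mathfrak{g}\to D$ is a $\rho$-$1$-cocycle, i.e. $\eta$ is linear with $\eta([X,Y])=\rho(X)\eta(Y)-\rho(Y)\eta(X)$ for $X,Y\in\mathfrak{g}$; (c) $\psi:\mathfrak{g}\to\mathbb{C}$ is a (real-)linear functional with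 purely imaginary values such that $\psi([X,Y])=\langle\eta(Y),\eta(X)\rangle-\langle\eta(X),\eta(Y)\rangle$ for $X,Y\in\mathfrak{g}$. *)

theory Defs
  imports "HOL-Analysis.Analysis" "HOL-Library.Poly_Mapping"
begin

section \<open>Schuermann triples on a real Lie algebra\<close>

locale real_lie_algebra =
  fixes bracket :: "'g::real_vector \<Rightarrow> 'g \<Rightarrow> 'g"
  assumes bracket_bilinear: "bilinear bracket"
    and bracket_self: "bracket X X = 0"
    and jacobi: "bracket X (bracket Y Z) + bracket Y (bracket Z X) + bracket Z (bracket X Y) = 0"

text \<open>The inner product is antilinear in the first and linear in the second argument. With the
  opposite convention the right-hand side in the condition on \<open>\<psi>\<close> below would change its sign.\<close>

locale complex_pre_hilbert = vector_space scale
  for scale :: "complex \<Rightarrow> 'd::ab_group_add \<Rightarrow> 'd" +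
  fixes ip :: "'d \<Rightarrow> 'd \<Rightarrow> complex"
  assumes ip_add_right: "ip x (y + z) = ip x y + ip x z"
    and ip_scale_right: "ip x (scale a y) = a * ip x y"
    and ip_cnj: "ip y x = cnj (ip x y)"
    and ip_nonneg: "0 \<le> Re (ip x x)"
    and ip_definite: "ip x x = 0 \<Longrightarrow> x = 0"
begin

definition anti_hermitian :: "('d \<Rightarrow> 'd) \<Rightarrow> bool" where
  "anti_hermitian T \<longleftrightarrow>
     Vector_Spaces.linear scale scale T \<and> (\<forall>x y. ip (T x) y = - ip x (T y))"

end

locale schuermann_triple =
  real_lie_algebra bracket + complex_pre_hilbert scale ip
  for bracket :: "'g::real_vector \<Rightarrow> 'g \<Rightarrow> 'g"
    and scale :: "complex \<Rightarrow> 'd::ab_group_add \<Rightarrow> 'd"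
    and ip :: "'d \<Rightarrow> 'd \<Rightarrow> complex" +
  fixes \<rho> :: "'g \<Rightarrow> 'd \<Rightarrow> 'd"
    and \<eta> :: "'g \<Rightarrow> 'd"
    and \<psi> :: "'g \<Rightarrow> complex"
  assumes rho_anti_hermitian: "anti_hermitian (\<rho> X)"
    and rho_add: "\<rho> (X + Y) v = \<rho> X v + \<rho> Y v"
    and rho_scaleR: "\<rho> (r *\<^sub>R X) v = scale (of_real r) (\<rho> X v)"
    and rho_bracket: "\<rho> (bracket X Y) v = \<rho> X (\<rho> Y v) - \<rho> Y (\<rho> X v)"
    and eta_add: "\<eta> (X + Y) = \<eta> X + \<eta> Y"
    and eta_scaleR: "\<eta> (r *\<^sub>R X) = scale (of_real r) (\<eta> X)"
    and eta_cocycle: "\<eta> (bracket X Y) = \<rho> X (\<eta> Y) - \<rho> Y (\<eta> X)"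
    and psi_linear: "linear \<psi>"
    and psi_imaginary: "Re (\<psi> X) = 0"
    and psi_bracket: "\<psi> (bracket X Y) = ip (\<eta> Y) (\<eta> X) - ip (\<eta> X) (\<eta> Y)"


section \<open>The Lie algebra so(3,1)\<close>

text \<open>The pair \<open>(h, f)\<close> stands for the element \<open>\<Sum>j. h\<^sub>j H\<^sub>j + f\<^sub>j F\<^sub>j\<close> of the complexification.\<close>

type_synonym so31C = "(complex ^ 3) \<times> (complex ^ 3)"

definition H :: "3 \<Rightarrow> so31C" where "H j = (axis j 1, 0)"
definition F :: "3 \<Rightarrow> so31C" where "F j = (0, axis j 1)"

definition scaleC :: "complex \<Rightarrow> so31C \<Rightarrow> so31C" where
  "scaleC a X = (a *s fst X, a *s snd X)"

definition levi_civita :: "3 \<Rightarrow> 3 \<Rightarrow> 3 \<Rightarrow> complex" where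
  "levi_civita j k l =
     (if (j, k, l) \<in> {(1, 2, 3), (2, 3, 1), (3, 1, 2)} then 1
      else if (j, k, l) \<in> {(1, 3, 2), (3, 2, 1), (2, 1, 3)} then -1
      else 0)"

text \<open>The bilinear extension of the relations stated in \<open>bracket_H_H\<close>, \<open>bracket_F_F\<close> and
  \<open>bracket_F_H\<close> below.\<close>

definition bracketC :: "so31C \<Rightarrow> so31C \<Rightarrow> so31C" where
  "bracketC X Y =
     ((\<chi> l. \<Sum>j\<in>UNIV. \<Sum>k\<in>UNIV. \<i> * levi_civita j k l * (fst X $ j * fst Y $ k - snd X $ j * snd Y $ k)),
      (\<chi> l. \<Sum>j\<in>UNIV. \<Sum>k\<in>UNIV. \<i> * levi_civita j k l * (fst X $ j * snd Y $ k + snd X $ j * fst Y $ k)))"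

definition star :: "so31C \<Rightarrow> so31C" where
  "star X = ((\<chi> j. cnj (fst X $ j)), (\<chi> j. cnj (snd X $ j)))"

lemma so31C_eqI:
  assumes "fst X $ 1 = fst Y $ 1" "fst X $ 2 = fst Y $ 2" "fst X $ 3 = fst Y $ 3"
    "snd X $ 1 = snd Y $ 1" "snd X $ 2 = snd Y $ 2" "snd X $ 3 = snd Y $ 3"
  shows "X = (Y :: so31C)"
  using assms by (simp add: prod_eq_iff vec_eq_iff forall_3)

lemma bracketC_components:
  "fst (bracketC X Y) $ 1 = \<i> * (fst X $ 2 * fst Y $ 3 - fst X $ 3 * fst Y $ 2 - (snd X $ 2 * snd Y $ 3 - snd X $ 3 * snd Y $ 2))"
  "fst (bracketC X Y) $ 2 = \<i> * (fst X $ 3 * fst Y $ 1 - fst X $ 1 * fst Y $ 3 - (snd X $ 3 * snd Y $ 1 - snd X $ 1 * snd Y $ 3))"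
  "fst (bracketC X Y) $ 3 = \<i> * (fst X $ 1 * fst Y $ 2 - fst X $ 2 * fst Y $ 1 - (snd X $ 1 * snd Y $ 2 - snd X $ 2 * snd Y $ 1))"
  "snd (bracketC X Y) $ 1 = \<i> * (fst X $ 2 * snd Y $ 3 - fst X $ 3 * snd Y $ 2 + (snd X $ 2 * fst Y $ 3 - snd X $ 3 * fst Y $ 2))"
  "snd (bracketC X Y) $ 2 = \<i> * (fst X $ 3 * snd Y $ 1 - fst X $ 1 * snd Y $ 3 + (snd X $ 3 * fst Y $ 1 - snd X $ 1 * fst Y $ 3))"
  "snd (bracketC X Y) $ 3 = \<i> * (fst X $ 1 * snd Y $ 2 - fst X $ 2 * snd Y $ 1 + (snd X $ 1 * fst Y $ 2 - snd X $ 2 * fst Y $ 1))"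
  by (simp_all add: bracketC_def levi_civita_def sum_3) (simp_all add: algebra_simps)

lemma bracket_H_H: "bracketC (H j) (H k) = (\<Sum>l\<in>UNIV. scaleC (\<i> * levi_civita j k l) (H l))"
  using exhaust_3[of j] exhaust_3[of k]
  by (elim disjE; intro so31C_eqI)
    (simp_all add: bracketC_components sum_3 scaleC_def levi_civita_def H_def F_def axis_def)

lemma bracket_F_F: "bracketC (F j) (F k) = (\<Sum>l\<in>UNIV. scaleC (- \<i> * levi_civita j k l) (H l))"
  using exhaust_3[of j] exhaust_3[of k]
  by (elim disjE; intro so31C_eqI)
    (simp_all add: bracketC_components sum_3 scaleC_def levi_civita_def H_def F_def axis_def)

lemma bracket_F_H: "bracketC (F j) (H k) = (\<Sum>l\<in>UNIV. scaleC (\<i> * levi_civita j k l) (F l))"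
  using exhaust_3[of j] exhaust_3[of k]
  by (elim disjE; intro so31C_eqI)
    (simp_all add: bracketC_components sum_3 scaleC_def levi_civita_def H_def F_def axis_def)

lemma star_H: "star (H j) = H j" and star_F: "star (F j) = F j"
  by (auto simp: H_def F_def star_def prod_eq_iff vec_eq_iff axis_def)

lemma star_bracket: "star (bracketC X Y) = bracketC (star Y) (star X)"
  by (rule so31C_eqI; simp add: bracketC_components star_def) (simp_all add: algebra_simps)

typedef so31 = "{X :: so31C. star X = - X}"
  by (rule exI[of _ 0]) (simp add: star_def prod_eq_iff vec_eq_iff)

setup_lifting type_definition_so31

instantiation so31 :: real_vector
begin
lift_definition zero_so31 :: so31 is 0
  by (simp add: star_def prod_eq_iff vec_eq_iff)
lift_definition plus_so31 :: "so31 \<Rightarrow> so31 \<Rightarrow> so31" is "(+)"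
  by (simp add: star_def prod_eq_iff vec_eq_iff)
lift_definition uminus_so31 :: "so31 \<Rightarrow> so31" is uminus
  by (simp add: star_def prod_eq_iff vec_eq_iff)
lift_definition minus_so31 :: "so31 \<Rightarrow> so31 \<Rightarrow> so31" is "(-)"
  by (simp add: star_def prod_eq_iff vec_eq_iff)
lift_definition scaleR_so31 :: "real \<Rightarrow> so31 \<Rightarrow> so31" is scaleR
  by (simp add: star_def prod_eq_iff vec_eq_iff)
instance
  by standard (transfer; simp add: algebra_simps)+
end

lift_definition so31_bracket :: "so31 \<Rightarrow> so31 \<Rightarrow> so31" is bracketC
proof -
  fix X Y :: so31C
  assume "star X = - X" "star Y = - Y"
  then have "star (bracketC X Y) = bracketC (- Y) (- X)"
    by (simp add: star_bracket)
  also have "\<dots> = - bracketC X Y"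
    by (rule so31C_eqI; simp add: bracketC_components) (simp_all add: algebra_simps)
  finally show "star (bracketC X Y) = - bracketC X Y" .
qed

interpretation so31: real_lie_algebra so31_bracket
proof
  have "bracketC (X + Y) Z = bracketC X Z + bracketC Y Z"
    "bracketC X (Y + Z) = bracketC X Y + bracketC X Z"
    "bracketC (r *\<^sub>R X) Y = r *\<^sub>R bracketC X Y"
    "bracketC X (r *\<^sub>R Y) = r *\<^sub>R bracketC X Y" for X Y Z r
    by (rule so31C_eqI; simp add: bracketC_components algebra_simps)+
  then show "bilinear so31_bracket"
    unfolding bilinear_def linear_iff by (intro conjI allI; transfer; simp)
  show "so31_bracket X X = 0" for X
    by (transfer, rule so31C_eqI) (simp_all add: bracketC_components algebra_simps)
  have "bracketC X (bracketC Y Z) + bracketC Y (bracketC Z X) + bracketC Z (bracketC X Y) = 0"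
    for X Y Z
    by (rule so31C_eqI; simp add: bracketC_components; algebra)
  then show "so31_bracket X (so31_bracket Y Z) + so31_bracket Y (so31_bracket Z X)
      + so31_bracket Z (so31_bracket X Y) = 0" for X Y Z
    by transfer simp
qed


section \<open>The pre-Hilbert space\<close>

typedef d10_index = "{(l :: int, m :: int). 1 \<le> l \<and> \<bar>m\<bar> \<le> l}"
  by (rule exI[of _ "(1, 0)"]) simp

text \<open>Finitely supported families of coefficients, i.e. the algebraic span of the
  \<open>\<xi>\<^sub>l\<^sub>m\<close>.\<close>

type_synonym D10 = "d10_index \<Rightarrow>\<^sub>0 complex"

text \<open>The value \<open>0\<close> outside the index range only ever occurs below with a vanishing coefficient.\<close>

definition xi :: "int \<Rightarrow> int \<Rightarrow> D10" where
  "xi l m = (if 1 \<le> l \<and> \<bar>m\<bar> \<le> l then Poly_Mapping.single (Abs_d10_index (l, m)) 1 else 0)"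

definition d10_scale :: "complex \<Rightarrow> D10 \<Rightarrow> D10" where
  "d10_scale a = Poly_Mapping.map ((*) a)"

definition d10_inner :: "D10 \<Rightarrow> D10 \<Rightarrow> complex" where
  "d10_inner v w = (\<Sum>k\<in>Poly_Mapping.keys v. cnj (Poly_Mapping.lookup v k) * Poly_Mapping.lookup w k)"

lemma lookup_d10_scale [simp]: "Poly_Mapping.lookup (d10_scale a v) k = a * Poly_Mapping.lookup v k"
  by (simp add: d10_scale_def Poly_Mapping.map.rep_eq when_def)

lemma d10_inner_superset:
  assumes "finite S" "Poly_Mapping.keys v \<subseteq> S"
  shows "d10_inner v w = (\<Sum>k\<in>S. cnj (Poly_Mapping.lookup v k) * Poly_Mapping.lookup w k)"
  unfolding d10_inner_def
  by (rule sum.mono_neutral_left) (use assms in \<open>auto simp: in_keys_iff\<close>)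

interpretation D10: complex_pre_hilbert d10_scale d10_inner
proof
  fix a b :: complex and x y z :: D10
  show "d10_scale a (x + y) = d10_scale a x + d10_scale a y"
    by (rule poly_mapping_eqI) (simp add: lookup_add algebra_simps)
  show "d10_scale (a + b) x = d10_scale a x + d10_scale b x"
    by (rule poly_mapping_eqI) (simp add: lookup_add algebra_simps)
  show "d10_scale a (d10_scale b x) = d10_scale (a * b) x"
    by (rule poly_mapping_eqI) simp
  show "d10_scale 1 x = x"
    by (rule poly_mapping_eqI) simp
  show "d10_inner x (y + z) = d10_inner x y + d10_inner x z"
    by (simp add: d10_inner_def lookup_add algebra_simps sum.distrib)
  show "d10_inner x (d10_scale a y) = a * d10_inner x y"
    by (simp add: d10_inner_def sum_distrib_left algebra_simps)
  show "d10_inner y x = cnj (d10_inner x y)"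
    using d10_inner_superset[of "Poly_Mapping.keys x \<union> Poly_Mapping.keys y" x y] d10_inner_superset[of "Poly_Mapping.keys x \<union> Poly_Mapping.keys y" y x]
    by (simp add: mult.commute)
  have eq: "d10_inner x x = of_real (\<Sum>k\<in>Poly_Mapping.keys x. (cmod (Poly_Mapping.lookup x k))\<^sup>2)"
    unfolding d10_inner_def of_real_sum
    by (rule sum.cong) (simp_all add: complex_norm_square mult.commute del: of_real_power)
  show "0 \<le> Re (d10_inner x x)"
    by (simp add: eq sum_nonneg)
  show "x = 0" if "d10_inner x x = 0"
  proof -
    have "(\<Sum>k\<in>Poly_Mapping.keys x. (cmod (Poly_Mapping.lookup x k))\<^sup>2) = 0"
      using that eq by (metis of_real_eq_0_iff)
    then have "\<forall>k\<in>Poly_Mapping.keys x. Poly_Mapping.lookup x k = 0"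
      by (subst (asm) sum_nonneg_eq_0_iff) auto
    then show "x = 0"
      by (auto intro!: poly_mapping_eqI simp: in_keys_iff)
  qed
qed

lemma xi_orthonormal:
  assumes "1 \<le> l" "\<bar>m\<bar> \<le> l" "1 \<le> l'" "\<bar>m'\<bar> \<le> l'"
  shows "d10_inner (xi l m) (xi l' m') = (if l = l' \<and> m = m' then 1 else 0)"
  using assms by (auto simp: d10_inner_def xi_def lookup_single when_def Abs_d10_index_inject)


section \<open>The representation and the cocycle\<close>

definition lin_ext :: "(int \<Rightarrow> int \<Rightarrow> D10) \<Rightarrow> D10 \<Rightarrow> D10" where
  "lin_ext T v = (\<Sum>k\<in>Poly_Mapping.keys v. d10_scale (Poly_Mapping.lookup v k) (case Rep_d10_index k of (l, m) \<Rightarrow> T l m))"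

lemma lin_ext_xi: "1 \<le> l \<Longrightarrow> \<bar>m\<bar> \<le> l \<Longrightarrow> lin_ext T (xi l m) = T l m"
  by (simp add: lin_ext_def xi_def Abs_d10_index_inverse)

definition C :: "int \<Rightarrow> complex" where
  "C l = \<i> * of_real (sqrt ((of_int l ^ 2 - 1) / (4 * of_int l ^ 2 - 1)))"

definition sqrt_int :: "int \<Rightarrow> complex" where
  "sqrt_int n = of_real (sqrt (of_int n))"

definition op_H3 :: "D10 \<Rightarrow> D10" where
  "op_H3 = lin_ext (\<lambda>l m. d10_scale (of_int m) (xi l m))"

definition op_Hplus :: "D10 \<Rightarrow> D10" where
  "op_Hplus = lin_ext (\<lambda>l m. d10_scale (sqrt_int ((l - m) * (l + m + 1))) (xi l (m + 1)))"

definition op_Hminus :: "D10 \<Rightarrow> D10" where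
  "op_Hminus = lin_ext (\<lambda>l m. d10_scale (sqrt_int ((l + m) * (l - m + 1))) (xi l (m - 1)))"

definition op_F3 :: "D10 \<Rightarrow> D10" where
  "op_F3 = lin_ext (\<lambda>l m.
     d10_scale (C l * sqrt_int (l ^ 2 - m ^ 2)) (xi (l - 1) m)
     - d10_scale (C (l + 1) * sqrt_int ((l + 1) ^ 2 - m ^ 2)) (xi (l + 1) m))"

definition op_Fplus :: "D10 \<Rightarrow> D10" where
  "op_Fplus = lin_ext (\<lambda>l m.
     d10_scale (C l * sqrt_int ((l - m) * (l - m - 1))) (xi (l - 1) (m + 1))
     + d10_scale (C (l + 1) * sqrt_int ((l + m + 1) * (l + m + 2))) (xi (l + 1) (m + 1)))"

definition op_Fminus :: "D10 \<Rightarrow> D10" where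
  "op_Fminus = lin_ext (\<lambda>l m.
     - d10_scale (C l * sqrt_int ((l + m) * (l + m - 1))) (xi (l - 1) (m - 1))
     - d10_scale (C (l + 1) * sqrt_int ((l - m + 1) * (l - m + 2))) (xi (l + 1) (m - 1)))"

text \<open>With \<open>H\<^sub>\<plusminus> = H\<^sub>1 \<plusminus> \<i> H\<^sub>2\<close> one has
  \<open>a\<^sub>1 H\<^sub>1 + a\<^sub>2 H\<^sub>2 = coord_plus a H\<^sub>+ + coord_minus a H\<^sub>-\<close>, and likewise for \<open>F\<close>.\<close>

definition coord_plus :: "complex ^ 3 \<Rightarrow> complex" where
  "coord_plus a = (a $ 1 - \<i> * a $ 2) / 2"

definition coord_minus :: "complex ^ 3 \<Rightarrow> complex" where
  "coord_minus a = (a $ 1 + \<i> * a $ 2) / 2"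

definition rho10_C :: "so31C \<Rightarrow> D10 \<Rightarrow> D10" where
  "rho10_C X v =
     d10_scale (fst X $ 3) (op_H3 v)
     + d10_scale (coord_plus (fst X)) (op_Hplus v) + d10_scale (coord_minus (fst X)) (op_Hminus v)
     + d10_scale (snd X $ 3) (op_F3 v)
     + d10_scale (coord_plus (snd X)) (op_Fplus v) + d10_scale (coord_minus (snd X)) (op_Fminus v)"

definition cocycle10_C :: "so31C \<Rightarrow> D10" where
  "cocycle10_C X =
     d10_scale (snd X $ 3) (d10_scale (- 1 / of_real (sqrt 2)) (xi 1 0))
     + d10_scale (coord_plus (snd X)) (xi 1 1)
     + d10_scale (coord_minus (snd X)) (- xi 1 (- 1))"

definition H_plus :: so31C where "H_plus = H 1 + scaleC \<i> (H 2)"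
definition H_minus :: so31C where "H_minus = H 1 - scaleC \<i> (H 2)"
definition F_plus :: so31C where "F_plus = F 1 + scaleC \<i> (F 2)"
definition F_minus :: so31C where "F_minus = F 1 - scaleC \<i> (F 2)"

lemmas generator_unfold = H_plus_def H_minus_def F_plus_def F_minus_def H_def F_def scaleC_def
  coord_plus_def coord_minus_def axis_def

lemma rho10_C_generators:
  "rho10_C (H 3) = op_H3" "rho10_C H_plus = op_Hplus" "rho10_C H_minus = op_Hminus"
  "rho10_C (F 3) = op_F3" "rho10_C F_plus = op_Fplus" "rho10_C F_minus = op_Fminus"
  by (auto simp: rho10_C_def generator_unfold fun_eq_iff)

lemma cocycle10_C_generators:
  "cocycle10_C (H 3) = 0" "cocycle10_C H_plus = 0" "cocycle10_C H_minus = 0"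
  "cocycle10_C (F 3) = d10_scale (- 1 / of_real (sqrt 2)) (xi 1 0)"
  "cocycle10_C F_plus = xi 1 1" "cocycle10_C F_minus = - xi 1 (- 1)"
  by (auto simp: cocycle10_C_def generator_unfold)

definition rho10 :: "so31 \<Rightarrow> D10 \<Rightarrow> D10" where
  "rho10 X = rho10_C (Rep_so31 X)"

definition cocycle10 :: "so31 \<Rightarrow> D10" where
  "cocycle10 X = cocycle10_C (Rep_so31 X)"

end

theory Submission
  imports Defs
begin

text \<open>The functional \<open>\<psi>\<close> is determined by its values on brackets because \<open>so(3,1)\<close> is perfect: every
  element is even a sum of two brackets (\<open>so31_sum_of_two_brackets\<close>).

  For existence \<open>\<psi> = 0\<close> works. The values \<open>c(F\<^sub>j)\<close> are orthogonal vectors of equal norm, so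
  \<open>\<langle>c(X), c(Y)\<rangle>\<close> is half the scalar product of the \<open>F\<close>-coordinates of \<open>X\<close> and \<open>Y\<close>; on the real form these
  coordinates are purely imaginary, which makes the inner product symmetric in \<open>X\<close> and \<open>Y\<close>
  (\<open>inner_cocycle10_commute\<close>). The required right-hand side for \<open>\<psi>([X,Y])\<close> therefore vanishes.

  What remains is that \<open>\<rho>\<^sub>1\<^sub>0\<close> is an anti-hermitian representation and \<open>c\<close> a cocycle. The matrix entries of
  the six ladder operators show that \<open>H\<^sub>3, F\<^sub>3\<close> are hermitian and \<open>H\<^sub>\<plusminus>\<close>, \<open>F\<^sub>\<plusminus>\<close> are mutually adjoint;
  hence \<open>\<rho>\<^sub>1\<^sub>0(X)\<^sup>* = \<rho>\<^sub>1\<^sub>0(X\<^sup>*)\<close>. Of the fifteen commutation relations, eight are checked on the vectors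
  \<open>\<xi>\<^sub>l\<^sub>m\<close>; taking adjoints gives six more, and \<open>[F\<^sub>+, F\<^sub>-]\<close> follows from the Jacobi identity. All but one of the
  eight would hold for any numbers \<open>C\<^sub>l\<close> with \<open>C\<^sub>1 = 0\<close>. The exception is \<open>[F\<^sub>+, F\<^sub>3] = H\<^sub>+\<close>, which amounts to
  the recurrence \<open>C_recurrence\<close>.

  The cocycle identity involves only the levels \<open>l = 1\<close> and \<open>l = 2\<close>. On level \<open>1\<close> it says that \<open>c\<close> is
  equivariant under the rotations \<open>H\<^sub>j\<close>; on level \<open>2\<close> it says that \<open>\<rho>\<^sub>1\<^sub>0(F\<^sub>j) c(F\<^sub>k)\<close> is
  symmetric in \<open>j\<close> and \<open>k\<close>.\<close>

section \<open>Linear operators on the pre-Hilbert space\<close>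

abbreviation d10_linear :: "(D10 \<Rightarrow> D10) \<Rightarrow> bool" where
  "d10_linear \<equiv> Vector_Spaces.linear d10_scale d10_scale"

lemma d10_linearD:
  assumes "d10_linear A"
  shows "A (v + w) = A v + A w" "A (v - w) = A v - A w" "A (- v) = - A v" "A 0 = 0"
    "A (d10_scale a v) = d10_scale a (A v)"
proof -
  interpret Vector_Spaces.linear d10_scale d10_scale A by fact
  show "A (v + w) = A v + A w" "A (v - w) = A v - A w" "A (- v) = - A v" "A 0 = 0"
    "A (d10_scale a v) = d10_scale a (A v)"
    by (simp_all add: add diff neg zero scale)
qed

lemma d10_linearI:
  assumes "\<And>v w. A (v + w) = A v + A w" "\<And>a v. A (d10_scale a v) = d10_scale a (A v)"
  shows "d10_linear A"
  using assms D10.vector_space_axioms by (simp add: Vector_Spaces.linear_iff)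

lemma lin_ext_superset:
  assumes "finite S" "Poly_Mapping.keys v \<subseteq> S"
  shows "lin_ext T v =
    (\<Sum>k\<in>S. d10_scale (Poly_Mapping.lookup v k) (case Rep_d10_index k of (l, m) \<Rightarrow> T l m))"
  unfolding lin_ext_def
  by (rule sum.mono_neutral_left) (use assms in \<open>auto simp: in_keys_iff\<close>)

lemma linear_lin_ext: "d10_linear (lin_ext T)"
proof (rule d10_linearI)
  fix a and v w :: D10
  let ?S = "Poly_Mapping.keys v \<union> Poly_Mapping.keys w"
  show "lin_ext T (v + w) = lin_ext T v + lin_ext T w"
    using Poly_Mapping.keys_add[of v w]
    by (simp add: lin_ext_superset[of ?S] lookup_add D10.scale_left_distrib sum.distrib)
  have "Poly_Mapping.keys (d10_scale a v) \<subseteq> Poly_Mapping.keys v"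
    by (auto simp: in_keys_iff)
  then show "lin_ext T (d10_scale a v) = d10_scale a (lin_ext T v)"
    by (simp add: lin_ext_superset[of "Poly_Mapping.keys v"] D10.scale_sum_right)
qed

lemma lin_ext_xi_self: "lin_ext xi v = v"
proof (rule poly_mapping_eqI)
  fix k
  have "(case Rep_d10_index j of (l, m) \<Rightarrow> xi l m) = Poly_Mapping.single j 1" for j
    using Rep_d10_index[of j] by (auto simp: xi_def split: prod.splits) (metis Rep_d10_index_inverse)
  then show "Poly_Mapping.lookup (lin_ext xi v) k = Poly_Mapping.lookup v k"
    by (simp add: lin_ext_def lookup_sum lookup_single when_def in_keys_iff if_distrib sum.delta
        cong: if_cong)
qed

lemma d10_induct [case_names xi add scale]:
  assumes xi: "\<And>l m. 1 \<le> l \<Longrightarrow> \<bar>m\<bar> \<le> l \<Longrightarrow> P (xi l m)"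
    and add: "\<And>v w. P v \<Longrightarrow> P w \<Longrightarrow> P (v + w)"
    and scale: "\<And>a v. P v \<Longrightarrow> P (d10_scale a v)"
  shows "P v"
proof -
  have zero: "P 0"
    using scale[OF xi[of 1 0], of 0] by simp
  have basis: "P (case Rep_d10_index k of (l, m) \<Rightarrow> xi l m)" for k
    using Rep_d10_index[of k] xi by auto
  have "P (\<Sum>k\<in>S. d10_scale (f k) (case Rep_d10_index k of (l, m) \<Rightarrow> xi l m))" for S f
    by (induction S rule: infinite_finite_induct) (simp_all add: zero add scale basis)
  then have "P (lin_ext xi v)"
    unfolding lin_ext_def .
  then show ?thesis
    by (simp only: lin_ext_xi_self)
qed

lemma linear_eqI_xi:
  assumes "d10_linear A" "d10_linear B"
    and "\<And>l m. 1 \<le> l \<Longrightarrow> \<bar>m\<bar> \<le> l \<Longrightarrow> A (xi l m) = B (xi l m)"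
  shows "A v = B v"
  by (induction v rule: d10_induct)
    (simp_all add: assms(3) assms(1,2)[THEN d10_linearD(1)] assms(1,2)[THEN d10_linearD(5)])

section \<open>The ladder operators on the orthonormal basis\<close>

lemmas op_defs = op_H3_def op_Hplus_def op_Hminus_def op_F3_def op_Fplus_def op_Fminus_def

lemma linear_ops:
  "d10_linear op_H3" "d10_linear op_Hplus" "d10_linear op_Hminus"
  "d10_linear op_F3" "d10_linear op_Fplus" "d10_linear op_Fminus"
  by (simp_all add: op_defs linear_lin_ext)

lemmas op_linear_simps = linear_ops[THEN d10_linearD(1)] linear_ops[THEN d10_linearD(2)]
  linear_ops[THEN d10_linearD(3)] linear_ops[THEN d10_linearD(4)] linear_ops[THEN d10_linearD(5)]

text \<open>Multiplicativity holds for negative arguments as well, since the real square root is an odd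
  function.\<close>

lemma sqrt_int_mult: "sqrt_int (a * b) = sqrt_int a * sqrt_int b"
  by (simp add: sqrt_int_def real_sqrt_mult)

lemma sqrt_int_0 [simp]: "sqrt_int 0 = 0"
  by (simp add: sqrt_int_def)

lemma sqrt_int_cancel:
  assumes "0 \<le> a"
  shows "sqrt_int a * sqrt_int a = of_int a" "sqrt_int a * (sqrt_int a * z) = of_int a * z"
proof -
  show *: "sqrt_int a * sqrt_int a = of_int a"
    using assms by (simp add: sqrt_int_def flip: of_real_mult)
  show "sqrt_int a * (sqrt_int a * z) = of_int a * z"
    by (simp add: * flip: mult.assoc)
qed

lemma cnj_sqrt_int [simp]: "cnj (sqrt_int a) = sqrt_int a"
  by (simp add: sqrt_int_def)

lemma cnj_C [simp]: "cnj (C l) = - C l"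
  by (simp add: C_def)

lemma C_1 [simp]: "C 1 = 0"
  by (simp add: C_def)

lemma xi_outside: "\<not> (1 \<le> l \<and> \<bar>m\<bar> \<le> l) \<Longrightarrow> xi l m = 0"
  by (simp only: xi_def if_False)

lemma scale_xi_outside:
  assumes "1 \<le> l \<Longrightarrow> \<bar>m\<bar> \<le> l \<Longrightarrow> a = 0"
  shows "d10_scale a (xi l m) = 0"
  using assms by (cases "1 \<le> l \<and> \<bar>m\<bar> \<le> l") (auto simp: xi_outside)

lemma lin_ext_xi_all:
  assumes "\<not> (1 \<le> l \<and> \<bar>m\<bar> \<le> l) \<Longrightarrow> T l m = 0"
  shows "lin_ext T (xi l m) = T l m"
  using assms lin_ext_xi[of l m T] d10_linearD(4)[OF linear_lin_ext] xi_outside[of l m] by metis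

text \<open>These formulas hold without any restriction on \<open>l\<close> and \<open>m\<close>: whenever an operator would lead from
  outside the index range into it, its coefficient vanishes. So operators can be composed on the
  \<open>\<xi>\<^sub>l\<^sub>m\<close> without distinguishing whether intermediate indices are in range. The radicands are
  factored so that products of coefficients can be compared factor by factor.\<close>

lemma op_xi:
  "op_H3 (xi l m) = d10_scale (of_int m) (xi l m)"
  "op_Hplus (xi l m) = d10_scale (sqrt_int (l - m) * sqrt_int (l + m + 1)) (xi l (m + 1))"
  "op_Hminus (xi l m) = d10_scale (sqrt_int (l + m) * sqrt_int (l - m + 1)) (xi l (m - 1))"
  "op_F3 (xi l m) =
     d10_scale (C l * (sqrt_int (l - m) * sqrt_int (l + m))) (xi (l - 1) m)
     - d10_scale (C (l + 1) * (sqrt_int (l - m + 1) * sqrt_int (l + m + 1))) (xi (l + 1) m)"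
  "op_Fplus (xi l m) =
     d10_scale (C l * (sqrt_int (l - m) * sqrt_int (l - m - 1))) (xi (l - 1) (m + 1))
     + d10_scale (C (l + 1) * (sqrt_int (l + m + 1) * sqrt_int (l + m + 2))) (xi (l + 1) (m + 1))"
  "op_Fminus (xi l m) =
     - d10_scale (C l * (sqrt_int (l + m) * sqrt_int (l + m - 1))) (xi (l - 1) (m - 1))
     - d10_scale (C (l + 1) * (sqrt_int (l - m + 1) * sqrt_int (l - m + 2))) (xi (l + 1) (m - 1))"
proof -
  have factor: "sqrt_int (l ^ 2 - m ^ 2) = sqrt_int (l - m) * sqrt_int (l + m)" for l m
    by (simp add: algebra_simps power2_eq_square flip: sqrt_int_mult)
  have same: "sqrt_int a * sqrt_int b = 0" if "a = 0 \<or> b = 0" for a b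
    using that by auto
  have up: "C (l + 1) * (sqrt_int a * sqrt_int b) = 0" if "l = 0 \<or> a = 0 \<or> b = 0" for a b
    using that by auto
  have down: "z = 0" if "\<not> (1 \<le> l \<and> \<bar>m\<bar> \<le> l)" "1 \<le> l - 1" "\<bar>m + d\<bar> \<le> l - 1" "\<bar>d\<bar> \<le> 1"
    for d :: int and z :: complex
    using that by linarith
  have zero: "x - y = 0" "x + y = 0" "- x - y = 0" if "x = 0" "y = 0" for x y :: D10
    using that by auto
  show "op_H3 (xi l m) = d10_scale (of_int m) (xi l m)"
    unfolding op_defs by (subst lin_ext_xi_all) (auto simp: xi_outside)
  show "op_Hplus (xi l m) = d10_scale (sqrt_int (l - m) * sqrt_int (l + m + 1)) (xi l (m + 1))"
    unfolding op_defs sqrt_int_mult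
    by (subst lin_ext_xi_all, rule scale_xi_outside, rule same, linarith, rule refl)
  show "op_Hminus (xi l m) = d10_scale (sqrt_int (l + m) * sqrt_int (l - m + 1)) (xi l (m - 1))"
    unfolding op_defs sqrt_int_mult
    by (subst lin_ext_xi_all, rule scale_xi_outside, rule same, linarith, rule refl)
  show "op_F3 (xi l m) =
     d10_scale (C l * (sqrt_int (l - m) * sqrt_int (l + m))) (xi (l - 1) m)
     - d10_scale (C (l + 1) * (sqrt_int (l - m + 1) * sqrt_int (l + m + 1))) (xi (l + 1) m)"
    unfolding op_defs factor
    by (subst lin_ext_xi_all, intro zero scale_xi_outside)
      (rule down[of "0"], simp, simp, simp, simp, rule up, linarith, simp add: algebra_simps)
  show "op_Fplus (xi l m) =
     d10_scale (C l * (sqrt_int (l - m) * sqrt_int (l - m - 1))) (xi (l - 1) (m + 1))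
     + d10_scale (C (l + 1) * (sqrt_int (l + m + 1) * sqrt_int (l + m + 2))) (xi (l + 1) (m + 1))"
    unfolding op_defs sqrt_int_mult
    by (subst lin_ext_xi_all, intro zero scale_xi_outside)
      (rule down[of "1"], simp, simp, simp, simp, rule up, linarith, rule refl)
  show "op_Fminus (xi l m) =
     - d10_scale (C l * (sqrt_int (l + m) * sqrt_int (l + m - 1))) (xi (l - 1) (m - 1))
     - d10_scale (C (l + 1) * (sqrt_int (l - m + 1) * sqrt_int (l - m + 2))) (xi (l + 1) (m - 1))"
    unfolding op_defs sqrt_int_mult
    by (subst lin_ext_xi_all, intro zero scale_xi_outside)
      (rule down[of "- 1"], simp, simp, simp, simp, rule up, linarith, rule refl)
qed

section \<open>Adjoints\<close>

lemma d10_inner_simps: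
  "d10_inner (x + y) z = d10_inner x z + d10_inner y z"
  "d10_inner (x - y) z = d10_inner x z - d10_inner y z"
  "d10_inner (- x) z = - d10_inner x z"
  "d10_inner (d10_scale a x) z = cnj a * d10_inner x z"
  "d10_inner x (y + z) = d10_inner x y + d10_inner x z"
  "d10_inner x (y - z) = d10_inner x y - d10_inner x z"
  "d10_inner x (- z) = - d10_inner x z"
  "d10_inner x (d10_scale a z) = a * d10_inner x z"
proof -
  show add: "d10_inner x (y + z) = d10_inner x y + d10_inner x z" for x y z
    by (rule D10.ip_add_right)
  show scale: "d10_inner x (d10_scale a z) = a * d10_inner x z" for x a z
    by (rule D10.ip_scale_right)
  show neg: "d10_inner x (- z) = - d10_inner x z" for x z
    using scale[of x "-1" z] by simp
  show diff: "d10_inner x (y - z) = d10_inner x y - d10_inner x z" for x y z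
    using add[of x y "- z"] neg[of x z] by simp
  show "d10_inner (x + y) z = d10_inner x z + d10_inner y z"
    "d10_inner (x - y) z = d10_inner x z - d10_inner y z"
    "d10_inner (- x) z = - d10_inner x z"
    "d10_inner (d10_scale a x) z = cnj a * d10_inner x z"
    unfolding D10.ip_cnj[of "x + y" z] D10.ip_cnj[of "x - y" z] D10.ip_cnj[of "- x" z]
      D10.ip_cnj[of "d10_scale a x" z] D10.ip_cnj[of x z] D10.ip_cnj[of y z]
    by (simp_all add: add scale neg diff)
qed

lemma d10_inner_eqI:
  assumes "\<And>u. d10_inner u v = d10_inner u w"
  shows "v = w"
  using D10.ip_definite[of "v - w"] assms[of "v - w"] by (simp add: d10_inner_simps)

definition d10_adjoint :: "(D10 \<Rightarrow> D10) \<Rightarrow> (D10 \<Rightarrow> D10) \<Rightarrow> bool" where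
  "d10_adjoint A B \<longleftrightarrow> (\<forall>v w. d10_inner (A v) w = d10_inner v (B w))"

lemma d10_adjointI_xi:
  assumes "d10_linear A" "d10_linear B"
    and "\<And>l m l' m'. 1 \<le> l \<Longrightarrow> \<bar>m\<bar> \<le> l \<Longrightarrow> 1 \<le> l' \<Longrightarrow> \<bar>m'\<bar> \<le> l' \<Longrightarrow>
      d10_inner (A (xi l m)) (xi l' m') = d10_inner (xi l m) (B (xi l' m'))"
  shows "d10_adjoint A B"
proof -
  note lin = assms(1,2)[THEN d10_linearD(1)] assms(1,2)[THEN d10_linearD(5)]
  have "d10_inner (A v) w = d10_inner v (B w)" for v w
  proof (induction v rule: d10_induct)
    case (xi l m)
    then show ?case
      by (induction w rule: d10_induct) (simp_all add: assms(3) lin d10_inner_simps)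
  qed (simp_all add: lin d10_inner_simps)
  then show ?thesis
    by (simp add: d10_adjoint_def)
qed

lemma d10_inner_xi:
  "d10_inner (xi l m) (xi l' m') = (if l = l' \<and> m = m' \<and> 1 \<le> l \<and> \<bar>m\<bar> \<le> l then 1 else 0)"
proof (cases "(1 \<le> l \<and> \<bar>m\<bar> \<le> l) \<and> (1 \<le> l' \<and> \<bar>m'\<bar> \<le> l')")
  case True
  then show ?thesis
    by (auto simp: xi_orthonormal)
next
  case False
  have "d10_inner 0 v = 0" "d10_inner v 0 = 0" for v
    by (simp_all add: d10_inner_def)
  then show ?thesis
    using False xi_outside by (cases "1 \<le> l \<and> \<bar>m\<bar> \<le> l") auto
qed

text \<open>The coefficients of \<open>F\<^sub>+\<close> and \<open>F\<^sub>-\<close> for opposite transitions differ in sign, as do those for going up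
  and down a level under \<open>F\<^sub>3\<close>. Complex conjugation makes up for this, as \<open>C\<^sub>l\<close> is purely imaginary.\<close>

lemma op_adjoints:
  "d10_adjoint op_H3 op_H3" "d10_adjoint op_Hplus op_Hminus" "d10_adjoint op_Hminus op_Hplus"
  "d10_adjoint op_F3 op_F3" "d10_adjoint op_Fplus op_Fminus" "d10_adjoint op_Fminus op_Fplus"
proof -
  have sym: "d10_adjoint B A" if "d10_adjoint A B" for A B
    using that unfolding d10_adjoint_def by (metis D10.ip_cnj)
  show "d10_adjoint op_H3 op_H3"
    by (rule d10_adjointI_xi[OF linear_ops(1,1)]) (simp add: op_xi d10_inner_simps d10_inner_xi)
  show H: "d10_adjoint op_Hplus op_Hminus"
    by (rule d10_adjointI_xi[OF linear_ops(2,3)])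
      (auto simp: op_xi d10_inner_simps d10_inner_xi algebra_simps)
  show "d10_adjoint op_F3 op_F3"
    by (rule d10_adjointI_xi[OF linear_ops(4,4)])
      (auto simp: op_xi d10_inner_simps d10_inner_xi algebra_simps)
  show F: "d10_adjoint op_Fplus op_Fminus"
    by (rule d10_adjointI_xi[OF linear_ops(5,6)])
      (auto simp: op_xi d10_inner_simps d10_inner_xi algebra_simps)
  show "d10_adjoint op_Hminus op_Hplus" "d10_adjoint op_Fminus op_Fplus"
    by (rule sym, fact)+
qed

section \<open>Commutation relations\<close>

lemma commutator_eqI_xi:
  assumes A: "d10_linear A" and B: "d10_linear B" and D: "d10_linear D"
    and xi: "\<And>l m. 1 \<le> l \<Longrightarrow> \<bar>m\<bar> \<le> l \<Longrightarrow>
      A (B (xi l m)) - B (A (xi l m)) = d10_scale a (D (xi l m))"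
  shows "A (B v) - B (A v) = d10_scale a (D v)"
proof (rule linear_eqI_xi[where A = "\<lambda>v. A (B v) - B (A v)"])
  note lin = A[THEN d10_linearD(1)] B[THEN d10_linearD(1)] D[THEN d10_linearD(1)]
    A[THEN d10_linearD(5)] B[THEN d10_linearD(5)] D[THEN d10_linearD(5)]
  show "d10_linear (\<lambda>v. A (B v) - B (A v))" "d10_linear (\<lambda>v. d10_scale a (D v))"
    by (rule d10_linearI; simp add: lin D10.scale_right_distrib D10.scale_right_diff_distrib
        D10.scale_left_commute)+
qed (fact xi)

text \<open>This turns a relation between raising operators into one between lowering operators.\<close>

lemma commutator_adjoint:
  assumes "\<And>v. A (B v) - B (A v) = d10_scale a (D v)"
    and "d10_adjoint A A'" "d10_adjoint B B'" "d10_adjoint D D'"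
  shows "B' (A' v) - A' (B' v) = d10_scale (cnj a) (D' v)"
proof (rule d10_inner_eqI)
  fix u
  have "d10_inner u (B' (A' v) - A' (B' v)) = d10_inner (A (B u) - B (A u)) v"
    using assms(2,3) by (simp add: d10_inner_simps d10_adjoint_def)
  also have "\<dots> = d10_inner u (d10_scale (cnj a) (D' v))"
    using assms(4) by (simp add: assms(1) d10_inner_simps d10_adjoint_def)
  finally show "d10_inner u (B' (A' v) - A' (B' v)) = d10_inner u (d10_scale (cnj a) (D' v))" .
qed

lemma C_square: "1 \<le> l \<Longrightarrow> C l * C l = - of_int (l ^ 2 - 1) / of_int (4 * l ^ 2 - 1)"
proof -
  assume l: "1 \<le> l"
  define y :: real where "y = (real_of_int l ^ 2 - 1) / (4 * real_of_int l ^ 2 - 1)"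
  have "real_of_int l ^ 2 \<ge> 1"
    using l by simp
  then have "y \<ge> 0"
    by (simp add: y_def)
  then have "of_real (sqrt y) * of_real (sqrt y) = (of_real y :: complex)"
    by (simp flip: of_real_mult)
  then have "C l * C l = - of_real y"
    by (simp add: C_def y_def[symmetric] algebra_simps)
  then show ?thesis
    by (simp add: y_def minus_divide_left)
qed

text \<open>With \<open>4l\<^sup>2 - 1 = (2l - 1)(2l + 1)\<close>, both terms become fractions with denominator \<open>2l + 1\<close>, and the
  numerators differ by \<open>(l + 1)\<^sup>2 - l\<^sup>2\<close>. Up to a common factor, the left-hand side is the coefficient of
  \<open>[F\<^sub>+, F\<^sub>3]\<close>.\<close>

lemma C_recurrence:
  assumes "1 \<le> l"
  shows "C l * C l * (2 * of_int l - 1) - C (l + 1) * C (l + 1) * (2 * of_int l + 3) = 1"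
proof -
  define x :: complex where "x = of_int l"
  have "2 * x - 1 = of_int (2 * l - 1)" "2 * x + 1 = of_int (2 * l + 1)"
    "2 * x + 3 = of_int (2 * l + 3)"
    by (simp_all add: x_def)
  moreover have "2 * l - 1 \<noteq> 0" "2 * l + 1 \<noteq> 0" "2 * l + 3 \<noteq> 0"
    using assms by linarith+
  ultimately have nz: "2 * x - 1 \<noteq> 0" "2 * x + 1 \<noteq> 0" "2 * x + 3 \<noteq> 0"
    by (simp_all only: of_int_eq_0_iff not_False_eq_True)
  have factor: "4 * x ^ 2 - 1 = (2 * x - 1) * (2 * x + 1)"
    "4 * (x + 1) ^ 2 - 1 = (2 * x + 1) * (2 * x + 3)"
    by (simp_all add: algebra_simps power2_eq_square)
  have "C l * C l * (2 * x - 1) = - (x ^ 2 - 1) / (2 * x + 1)"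
    using assms nz by (simp add: C_square factor flip: x_def)
  moreover have "C (l + 1) * C (l + 1) * (2 * x + 3) = - ((x + 1) ^ 2 - 1) / (2 * x + 1)"
    using assms nz by (simp add: C_square factor flip: x_def)
  ultimately have "C l * C l * (2 * x - 1) - C (l + 1) * C (l + 1) * (2 * x + 3)
      = (- (x ^ 2 - 1) - - ((x + 1) ^ 2 - 1)) / (2 * x + 1)"
    by (simp only: diff_divide_distrib)
  also have "\<dots> = 1"
    using nz by (simp add: power2_eq_square algebra_simps)
  finally show ?thesis
    by (simp only: x_def)
qed

lemmas xi_simps = op_xi op_linear_simps D10.scale_right_distrib D10.scale_right_diff_distrib

text \<open>Among the squares of square roots that arise in the relations below, only that of \<open>\<surd>(l - m - 1)\<close> can
  have a negative radicand. This happens for \<open>m = l\<close>, and then the factor \<open>\<surd>(l - m)\<close> next to it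
  is zero; hence the case distinction.\<close>

lemma commutator_H3_Hplus: "op_H3 (op_Hplus v) - op_Hplus (op_H3 v) = d10_scale 1 (op_Hplus v)"
proof (rule commutator_eqI_xi[OF linear_ops(1,2,2)], rule poly_mapping_eqI)
  fix l m :: int and k
  assume lm: "1 \<le> l" "\<bar>m\<bar> \<le> l"
  then have nonneg: "0 \<le> l - m" "0 \<le> l + m"
    by auto
  consider "m = l" | "0 \<le> l - (m + 1)"
    using nonneg by linarith
  then show "Poly_Mapping.lookup (op_H3 (op_Hplus (xi l m)) - op_Hplus (op_H3 (xi l m))) k
      = Poly_Mapping.lookup (d10_scale 1 (op_Hplus (xi l m))) k"
    by cases (use nonneg in \<open>simp_all only: xi_simps\<close>,
        use nonneg in \<open>simp_all add: lookup_add lookup_minus algebra_simps sqrt_int_cancel\<close>)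
qed

lemma commutator_Hplus_Hminus: "op_Hplus (op_Hminus v) - op_Hminus (op_Hplus v) = d10_scale 2 (op_H3 v)"
proof (rule commutator_eqI_xi[OF linear_ops(2,3,1)], rule poly_mapping_eqI)
  fix l m :: int and k
  assume lm: "1 \<le> l" "\<bar>m\<bar> \<le> l"
  then have nonneg: "0 \<le> l - m" "0 \<le> l + m"
    by auto
  consider "m = l" | "0 \<le> l - (m + 1)"
    using nonneg by linarith
  then show "Poly_Mapping.lookup (op_Hplus (op_Hminus (xi l m)) - op_Hminus (op_Hplus (xi l m))) k
      = Poly_Mapping.lookup (d10_scale 2 (op_H3 (xi l m))) k"
    by cases (use nonneg in \<open>simp_all only: xi_simps\<close>,
        use nonneg in \<open>simp_all add: lookup_add lookup_minus algebra_simps sqrt_int_cancel\<close>)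
qed

lemma commutator_H3_F3: "op_H3 (op_F3 v) - op_F3 (op_H3 v) = d10_scale 0 (op_F3 v)"
proof (rule commutator_eqI_xi[OF linear_ops(1,4,4)], rule poly_mapping_eqI)
  fix l m :: int and k
  assume lm: "1 \<le> l" "\<bar>m\<bar> \<le> l"
  then have nonneg: "0 \<le> l - m" "0 \<le> l + m"
    by auto
  consider "m = l" | "0 \<le> l - (m + 1)"
    using nonneg by linarith
  then show "Poly_Mapping.lookup (op_H3 (op_F3 (xi l m)) - op_F3 (op_H3 (xi l m))) k
      = Poly_Mapping.lookup (d10_scale 0 (op_F3 (xi l m))) k"
    by cases (use nonneg in \<open>simp_all only: xi_simps\<close>,
        use nonneg in \<open>simp_all add: lookup_add lookup_minus algebra_simps sqrt_int_cancel\<close>)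
qed

lemma commutator_H3_Fplus: "op_H3 (op_Fplus v) - op_Fplus (op_H3 v) = d10_scale 1 (op_Fplus v)"
proof (rule commutator_eqI_xi[OF linear_ops(1,5,5)], rule poly_mapping_eqI)
  fix l m :: int and k
  assume lm: "1 \<le> l" "\<bar>m\<bar> \<le> l"
  then have nonneg: "0 \<le> l - m" "0 \<le> l + m"
    by auto
  consider "m = l" | "0 \<le> l - (m + 1)"
    using nonneg by linarith
  then show "Poly_Mapping.lookup (op_H3 (op_Fplus (xi l m)) - op_Fplus (op_H3 (xi l m))) k
      = Poly_Mapping.lookup (d10_scale 1 (op_Fplus (xi l m))) k"
    by cases (use nonneg in \<open>simp_all only: xi_simps\<close>,
        use nonneg in \<open>simp_all add: lookup_add lookup_minus algebra_simps sqrt_int_cancel\<close>)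
qed

lemma commutator_Hplus_F3: "op_Hplus (op_F3 v) - op_F3 (op_Hplus v) = d10_scale (- 1) (op_Fplus v)"
proof (rule commutator_eqI_xi[OF linear_ops(2,4,5)], rule poly_mapping_eqI)
  fix l m :: int and k
  assume lm: "1 \<le> l" "\<bar>m\<bar> \<le> l"
  then have nonneg: "0 \<le> l - m" "0 \<le> l + m"
    by auto
  consider "m = l" | "0 \<le> l - (m + 1)"
    using nonneg by linarith
  then show "Poly_Mapping.lookup (op_Hplus (op_F3 (xi l m)) - op_F3 (op_Hplus (xi l m))) k
      = Poly_Mapping.lookup (d10_scale (- 1) (op_Fplus (xi l m))) k"
    by cases (use nonneg in \<open>simp_all only: xi_simps\<close>,
        use nonneg in \<open>simp_all add: lookup_add lookup_minus algebra_simps sqrt_int_cancel\<close>)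
qed

lemma commutator_Hplus_Fplus: "op_Hplus (op_Fplus v) - op_Fplus (op_Hplus v) = d10_scale 0 (op_Fplus v)"
proof (rule commutator_eqI_xi[OF linear_ops(2,5,5)], rule poly_mapping_eqI)
  fix l m :: int and k
  assume lm: "1 \<le> l" "\<bar>m\<bar> \<le> l"
  then have nonneg: "0 \<le> l - m" "0 \<le> l + m"
    by auto
  consider "m = l" | "0 \<le> l - (m + 1)"
    using nonneg by linarith
  then show "Poly_Mapping.lookup (op_Hplus (op_Fplus (xi l m)) - op_Fplus (op_Hplus (xi l m))) k
      = Poly_Mapping.lookup (d10_scale 0 (op_Fplus (xi l m))) k"
    by cases (use nonneg in \<open>simp_all only: xi_simps\<close>,
        use nonneg in \<open>simp_all add: lookup_add lookup_minus algebra_simps sqrt_int_cancel\<close>)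
qed

lemma commutator_Hminus_Fplus: "op_Hminus (op_Fplus v) - op_Fplus (op_Hminus v) = d10_scale (- 2) (op_F3 v)"
proof (rule commutator_eqI_xi[OF linear_ops(3,5,4)], rule poly_mapping_eqI)
  fix l m :: int and k
  assume lm: "1 \<le> l" "\<bar>m\<bar> \<le> l"
  then have nonneg: "0 \<le> l - m" "0 \<le> l + m"
    by auto
  consider "m = l" | "0 \<le> l - (m + 1)"
    using nonneg by linarith
  then show "Poly_Mapping.lookup (op_Hminus (op_Fplus (xi l m)) - op_Fplus (op_Hminus (xi l m))) k
      = Poly_Mapping.lookup (d10_scale (- 2) (op_F3 (xi l m))) k"
    by cases (use nonneg in \<open>simp_all only: xi_simps\<close>,
        use nonneg in \<open>simp_all add: lookup_add lookup_minus algebra_simps sqrt_int_cancel\<close>)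
qed

lemma commutator_Fplus_F3: "op_Fplus (op_F3 v) - op_F3 (op_Fplus v) = d10_scale 1 (op_Hplus v)"
proof (rule commutator_eqI_xi[OF linear_ops(5,4,2)], rule poly_mapping_eqI)
  fix l m :: int and k
  assume lm: "1 \<le> l" "\<bar>m\<bar> \<le> l"
  then have nonneg: "0 \<le> l - m" "0 \<le> l + m"
    by auto
  have recurrence: "C l * C l * (2 * of_int l - 1) - C (1 + l) * C (1 + l) * (2 * of_int l + 3) = 1"
    using C_recurrence[OF lm(1)] by (simp add: add.commute)
  consider "m = l" | "0 \<le> l - (m + 1)"
    using nonneg by linarith
  then show "Poly_Mapping.lookup (op_Fplus (op_F3 (xi l m)) - op_F3 (op_Fplus (xi l m))) k
      = Poly_Mapping.lookup (d10_scale 1 (op_Hplus (xi l m))) k"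
    by cases (use nonneg in \<open>simp_all only: xi_simps\<close>,
        use nonneg in \<open>simp_all add: lookup_add lookup_minus algebra_simps sqrt_int_cancel\<close>,
        use recurrence in algebra)
qed

text \<open>The relations that are new here are the adjoints of the previous ones, except for the last: substituting
  \<open>F\<^sub>- = [H\<^sub>-, F\<^sub>3]\<close> reduces it to commutators that are already known.\<close>

lemma commutators:
  "op_H3 (op_Hplus v) - op_Hplus (op_H3 v) = op_Hplus v"
  "op_H3 (op_Hminus v) - op_Hminus (op_H3 v) = - op_Hminus v"
  "op_Hplus (op_Hminus v) - op_Hminus (op_Hplus v) = d10_scale 2 (op_H3 v)"
  "op_H3 (op_F3 v) - op_F3 (op_H3 v) = 0"
  "op_H3 (op_Fplus v) - op_Fplus (op_H3 v) = op_Fplus v"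
  "op_H3 (op_Fminus v) - op_Fminus (op_H3 v) = - op_Fminus v"
  "op_Hplus (op_F3 v) - op_F3 (op_Hplus v) = - op_Fplus v"
  "op_Hminus (op_F3 v) - op_F3 (op_Hminus v) = op_Fminus v"
  "op_Hplus (op_Fplus v) - op_Fplus (op_Hplus v) = 0"
  "op_Hminus (op_Fminus v) - op_Fminus (op_Hminus v) = 0"
  "op_Hminus (op_Fplus v) - op_Fplus (op_Hminus v) = - d10_scale 2 (op_F3 v)"
  "op_Hplus (op_Fminus v) - op_Fminus (op_Hplus v) = d10_scale 2 (op_F3 v)"
  "op_F3 (op_Fplus v) - op_Fplus (op_F3 v) = - op_Hplus v"
  "op_F3 (op_Fminus v) - op_Fminus (op_F3 v) = op_Hminus v"
  "op_Fplus (op_Fminus v) - op_Fminus (op_Fplus v) = - d10_scale 2 (op_H3 v)"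
proof -
  show "op_H3 (op_Hplus v) - op_Hplus (op_H3 v) = op_Hplus v"
    using commutator_H3_Hplus by simp
  show "op_H3 (op_Hminus v) - op_Hminus (op_H3 v) = - op_Hminus v"
    using commutator_adjoint[OF commutator_H3_Hplus op_adjoints(1,2,2), of v]
    by (simp add: algebra_simps)
  show HH: "op_Hplus (op_Hminus v) - op_Hminus (op_Hplus v) = d10_scale 2 (op_H3 v)" for v
    by (rule commutator_Hplus_Hminus)
  show "op_H3 (op_F3 v) - op_F3 (op_H3 v) = 0"
    using commutator_H3_F3 by simp
  show "op_H3 (op_Fplus v) - op_Fplus (op_H3 v) = op_Fplus v"
    using commutator_H3_Fplus by simp
  show "op_H3 (op_Fminus v) - op_Fminus (op_H3 v) = - op_Fminus v"
    using commutator_adjoint[OF commutator_H3_Fplus op_adjoints(1,5,5), of v]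
    by (simp add: algebra_simps)
  show "op_Hplus (op_F3 v) - op_F3 (op_Hplus v) = - op_Fplus v"
    using commutator_Hplus_F3[of v] by simp
  show HF: "op_Hminus (op_F3 v) - op_F3 (op_Hminus v) = op_Fminus v" for v
    using commutator_adjoint[OF commutator_Hplus_F3 op_adjoints(2,4,5), of v]
    by (simp add: algebra_simps)
  show "op_Hplus (op_Fplus v) - op_Fplus (op_Hplus v) = 0"
    using commutator_Hplus_Fplus[of v] by simp
  show "op_Hminus (op_Fminus v) - op_Fminus (op_Hminus v) = 0"
    using commutator_adjoint[OF commutator_Hplus_Fplus op_adjoints(2,5,5), of v] by simp
  show HmFp: "op_Hminus (op_Fplus v) - op_Fplus (op_Hminus v) = - d10_scale 2 (op_F3 v)" for v
    using commutator_Hminus_Fplus[of v] by simp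
  show "op_Hplus (op_Fminus v) - op_Fminus (op_Hplus v) = d10_scale 2 (op_F3 v)"
    using commutator_adjoint[OF commutator_Hminus_Fplus op_adjoints(3,5,4), of v]
    by (simp add: algebra_simps)
  show FF: "op_F3 (op_Fplus v) - op_Fplus (op_F3 v) = - op_Hplus v" for v
    using commutator_Fplus_F3[of v] by (simp add: algebra_simps)
  show "op_F3 (op_Fminus v) - op_Fminus (op_F3 v) = op_Hminus v"
    using commutator_adjoint[OF commutator_Fplus_F3 op_adjoints(5,4,2), of v] by simp
  show "op_Fplus (op_Fminus v) - op_Fminus (op_Fplus v) = - d10_scale 2 (op_H3 v)"
  proof -
    have "op_Fplus (op_Fminus v) - op_Fminus (op_Fplus v)
      = op_Fplus (op_Hminus (op_F3 v)) - op_Fplus (op_F3 (op_Hminus v))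
        - (op_Hminus (op_F3 (op_Fplus v)) - op_F3 (op_Hminus (op_Fplus v)))"
      by (simp add: op_linear_simps flip: HF)
    also have "op_Fplus (op_Hminus (op_F3 v))
      = op_Hminus (op_Fplus (op_F3 v)) + d10_scale 2 (op_F3 (op_F3 v))"
      using HmFp[of "op_F3 v"] by (simp add: algebra_simps)
    also have "op_Fplus (op_F3 (op_Hminus v)) = op_F3 (op_Fplus (op_Hminus v)) + op_Hplus (op_Hminus v)"
      using FF[of "op_Hminus v"] by (simp add: algebra_simps)
    also have "op_F3 (op_Hminus (op_Fplus v))
      = op_F3 (op_Fplus (op_Hminus v)) - d10_scale 2 (op_F3 (op_F3 v))"
      using arg_cong[OF HmFp[of v], of op_F3] by (simp add: op_linear_simps algebra_simps)
    also have "op_Hminus (op_F3 (op_Fplus v))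
      = op_Hminus (op_Fplus (op_F3 v)) - op_Hminus (op_Hplus v)"
      using arg_cong[OF FF[of v], of op_Hminus] by (simp add: op_linear_simps algebra_simps)
    finally show ?thesis
      using HH[of v] by (simp add: algebra_simps)
  qed
qed

section \<open>The representation\<close>

text \<open>With respect to the basis \<open>H\<^sub>3, H\<^sub>\<plusminus>, F\<^sub>3, F\<^sub>\<plusminus>\<close>, in which \<open>rho10_C\<close> and \<open>cocycle10_C\<close> are
  given, the bracket has the structure constants that appear in the commutation relations above.\<close>

lemma bracketC_ladder_coordinates:
  "fst (bracketC X Y) $ 3 = 2 * (coord_plus (fst X) * coord_minus (fst Y) - coord_minus (fst X) * coord_plus (fst Y)
    - (coord_plus (snd X) * coord_minus (snd Y) - coord_minus (snd X) * coord_plus (snd Y)))"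
  "coord_plus (fst (bracketC X Y)) = fst X $ 3 * coord_plus (fst Y) - coord_plus (fst X) * fst Y $ 3
    - (snd X $ 3 * coord_plus (snd Y) - coord_plus (snd X) * snd Y $ 3)"
  "coord_minus (fst (bracketC X Y)) = coord_minus (fst X) * fst Y $ 3 - fst X $ 3 * coord_minus (fst Y)
    - (coord_minus (snd X) * snd Y $ 3 - snd X $ 3 * coord_minus (snd Y))"
  "snd (bracketC X Y) $ 3 = 2 * (coord_plus (fst X) * coord_minus (snd Y) - coord_minus (fst X) * coord_plus (snd Y)
    + (coord_plus (snd X) * coord_minus (fst Y) - coord_minus (snd X) * coord_plus (fst Y)))"
  "coord_plus (snd (bracketC X Y)) = fst X $ 3 * coord_plus (snd Y) - coord_plus (fst X) * snd Y $ 3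
    + (snd X $ 3 * coord_plus (fst Y) - coord_plus (snd X) * fst Y $ 3)"
  "coord_minus (snd (bracketC X Y)) = coord_minus (fst X) * snd Y $ 3 - fst X $ 3 * coord_minus (snd Y)
    + (coord_minus (snd X) * fst Y $ 3 - snd X $ 3 * coord_minus (fst Y))"
  by (simp_all add: bracketC_components coord_plus_def coord_minus_def field_simps)

lemma star_ladder_coordinates:
  "fst (star X) $ j = cnj (fst X $ j)" "snd (star X) $ j = cnj (snd X $ j)"
  "coord_plus (fst (star X)) = cnj (coord_minus (fst X))"
  "coord_minus (fst (star X)) = cnj (coord_plus (fst X))"
  "coord_plus (snd (star X)) = cnj (coord_minus (snd X))"
  "coord_minus (snd (star X)) = cnj (coord_plus (snd X))"
  by (simp_all add: star_def coord_plus_def coord_minus_def)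

lemma linear_rho10_C: "d10_linear (rho10_C X)"
  by (rule d10_linearI; simp add: rho10_C_def op_linear_simps D10.scale_right_distrib
      D10.scale_left_commute[of _ a for a] algebra_simps)

lemma rho10_C_adjoint: "d10_inner (rho10_C X v) w = d10_inner v (rho10_C (star X) w)"
  using op_adjoints unfolding d10_adjoint_def
  by (simp add: rho10_C_def star_ladder_coordinates d10_inner_simps)

lemma rho10_C_bracket:
  "rho10_C (bracketC X Y) v = rho10_C X (rho10_C Y v) - rho10_C Y (rho10_C X v)"
proof (rule poly_mapping_eqI)
  fix k
  \<comment> \<open>Each relation is oriented so that compositions are brought into a fixed order.\<close>
  note reorder = commutators[THEN arg_cong[of _ _ "\<lambda>w. Poly_Mapping.lookup w k"],
      unfolded lookup_minus lookup_uminus lookup_zero lookup_d10_scale diff_eq_eq]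
  show "Poly_Mapping.lookup (rho10_C (bracketC X Y) v) k
      = Poly_Mapping.lookup (rho10_C X (rho10_C Y v) - rho10_C Y (rho10_C X v)) k"
    unfolding rho10_C_def op_linear_simps bracketC_ladder_coordinates
      lookup_add lookup_minus lookup_d10_scale reorder
    by algebra
qed

section \<open>The cocycle\<close>

lemma op_xi_1:
  "op_H3 (xi 1 0) = 0" "op_H3 (xi 1 1) = xi 1 1" "op_H3 (xi 1 (- 1)) = - xi 1 (- 1)"
  "op_Hplus (xi 1 0) = d10_scale (sqrt_int 2) (xi 1 1)" "op_Hplus (xi 1 1) = 0"
  "op_Hplus (xi 1 (- 1)) = d10_scale (sqrt_int 2) (xi 1 0)"
  "op_Hminus (xi 1 0) = d10_scale (sqrt_int 2) (xi 1 (- 1))"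
  "op_Hminus (xi 1 1) = d10_scale (sqrt_int 2) (xi 1 0)" "op_Hminus (xi 1 (- 1)) = 0"
  "op_F3 (xi 1 0) = - d10_scale (2 * C 2) (xi 2 0)"
  "op_F3 (xi 1 1) = - d10_scale (C 2 * sqrt_int 3) (xi 2 1)"
  "op_F3 (xi 1 (- 1)) = - d10_scale (C 2 * sqrt_int 3) (xi 2 (- 1))"
  "op_Fplus (xi 1 0) = d10_scale (C 2 * (sqrt_int 2 * sqrt_int 3)) (xi 2 1)"
  "op_Fplus (xi 1 1) = d10_scale (2 * C 2 * sqrt_int 3) (xi 2 2)"
  "op_Fplus (xi 1 (- 1)) = d10_scale (C 2 * sqrt_int 2) (xi 2 0)"
  "op_Fminus (xi 1 0) = - d10_scale (C 2 * (sqrt_int 2 * sqrt_int 3)) (xi 2 (- 1))"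
  "op_Fminus (xi 1 1) = - d10_scale (C 2 * sqrt_int 2) (xi 2 0)"
  "op_Fminus (xi 1 (- 1)) = - d10_scale (2 * C 2 * sqrt_int 3) (xi 2 (- 2))"
proof -
  have "sqrt_int 1 = 1" "sqrt_int 4 = 2"
    by (simp_all add: sqrt_int_def)
  then show "op_H3 (xi 1 0) = 0" "op_H3 (xi 1 1) = xi 1 1" "op_H3 (xi 1 (- 1)) = - xi 1 (- 1)"
    "op_Hplus (xi 1 0) = d10_scale (sqrt_int 2) (xi 1 1)" "op_Hplus (xi 1 1) = 0"
    "op_Hplus (xi 1 (- 1)) = d10_scale (sqrt_int 2) (xi 1 0)"
    "op_Hminus (xi 1 0) = d10_scale (sqrt_int 2) (xi 1 (- 1))"
    "op_Hminus (xi 1 1) = d10_scale (sqrt_int 2) (xi 1 0)" "op_Hminus (xi 1 (- 1)) = 0"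
    "op_F3 (xi 1 0) = - d10_scale (2 * C 2) (xi 2 0)"
    "op_F3 (xi 1 1) = - d10_scale (C 2 * sqrt_int 3) (xi 2 1)"
    "op_F3 (xi 1 (- 1)) = - d10_scale (C 2 * sqrt_int 3) (xi 2 (- 1))"
    "op_Fplus (xi 1 0) = d10_scale (C 2 * (sqrt_int 2 * sqrt_int 3)) (xi 2 1)"
    "op_Fplus (xi 1 1) = d10_scale (2 * C 2 * sqrt_int 3) (xi 2 2)"
    "op_Fplus (xi 1 (- 1)) = d10_scale (C 2 * sqrt_int 2) (xi 2 0)"
    "op_Fminus (xi 1 0) = - d10_scale (C 2 * (sqrt_int 2 * sqrt_int 3)) (xi 2 (- 1))"
    "op_Fminus (xi 1 1) = - d10_scale (C 2 * sqrt_int 2) (xi 2 0)"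
    "op_Fminus (xi 1 (- 1)) = - d10_scale (2 * C 2 * sqrt_int 3) (xi 2 (- 2))"
    using sqrt_int_cancel(1)[of 2] by (simp_all add: op_xi mult.commute)
qed

lemma cocycle10_C_bracket:
  "cocycle10_C (bracketC X Y) = rho10_C X (cocycle10_C Y) - rho10_C Y (cocycle10_C X)"
proof (rule poly_mapping_eqI)
  fix k
  have half: "- 1 / of_real (sqrt 2) = - (sqrt_int 2 / 2)"
    by (simp add: sqrt_int_def real_div_sqrt field_simps flip: of_real_mult)
  \<comment> \<open>With \<open>t = 1 / \<surd>2\<close> the claim is polynomial, up to the relation \<open>2 t\<^sup>2 = 1\<close>.\<close>
  define t where "t = sqrt_int 2 / 2"
  have t: "sqrt_int 2 = 2 * t" "2 * (t * t) = 1"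
    using sqrt_int_cancel(1)[of 2] by (simp_all add: t_def)
  show "Poly_Mapping.lookup (cocycle10_C (bracketC X Y)) k
      = Poly_Mapping.lookup (rho10_C X (cocycle10_C Y) - rho10_C Y (cocycle10_C X)) k"
    unfolding cocycle10_C_def rho10_C_def bracketC_ladder_coordinates half t_def[symmetric]
      op_linear_simps op_xi_1 t(1) lookup_add lookup_minus lookup_uminus lookup_d10_scale lookup_zero
    using t(2) by algebra
qed

text \<open>This expresses that the vectors \<open>c(F\<^sub>j)\<close> are orthogonal and have squared norm \<open>1/2\<close>.\<close>

lemma d10_inner_cocycle10_C:
  "d10_inner (cocycle10_C X) (cocycle10_C Y) = (\<Sum>j\<in>UNIV. cnj (snd X $ j) * snd Y $ j) / 2"
proof -
  have "complex_of_real (sqrt 2) * complex_of_real (sqrt 2) = 2"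
    by (simp flip: of_real_mult)
  then show ?thesis
    by (simp add: cocycle10_C_def d10_inner_simps d10_inner_xi sum_3 coord_plus_def coord_minus_def
        field_simps)
qed

section \<open>The real form\<close>

lemma star_Rep_so31: "star (Rep_so31 X) = - Rep_so31 X"
  using Rep_so31[of X] by simp

lemma rho10_anti_hermitian: "D10.anti_hermitian (rho10 X)"
proof -
  have "rho10_C (- Z) w = - rho10_C Z w" for Z w
    by (rule poly_mapping_eqI)
      (simp add: rho10_C_def coord_plus_def coord_minus_def lookup_add lookup_minus field_simps)
  then show ?thesis
    by (simp add: D10.anti_hermitian_def rho10_def linear_rho10_C rho10_C_adjoint star_Rep_so31
        d10_inner_simps)
qed

lemma inner_cocycle10_commute:
  "d10_inner (cocycle10 X) (cocycle10 Y) = d10_inner (cocycle10 Y) (cocycle10 X)"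
proof -
  have imaginary: "cnj (snd (Rep_so31 Z) $ j) = - snd (Rep_so31 Z) $ j" for Z j
    using arg_cong[OF star_Rep_so31[of Z], of "\<lambda>W. snd W $ j"] by (simp add: star_def)
  show ?thesis
    by (simp add: cocycle10_def d10_inner_cocycle10_C imaginary mult.commute)
qed

text \<open>Bracketing with \<open>i H\<^sub>3\<close> rotates the coordinates \<open>1\<close> and \<open>2\<close> of both the \<open>H\<close>- and the \<open>F\<close>-part by a right
  angle and kills the coordinate \<open>3\<close>, which is then provided by a bracket with \<open>i H\<^sub>1\<close>.\<close>

lemma so31_sum_of_two_brackets:
  "\<exists>X Y X' Y'. Z = so31_bracket X Y + so31_bracket X' Y'"
proof (transfer, goal_cases)
  case (1 Z)
  define a b where "a = fst Z" and "b = snd Z"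
  have imaginary: "cnj (a $ j) = - a $ j" "cnj (b $ j) = - b $ j" for j
    using arg_cong[OF 1, of "\<lambda>W. fst W $ j"] arg_cong[OF 1, of "\<lambda>W. snd W $ j"]
    by (simp_all add: star_def a_def b_def)
  define X X' :: so31C where "X = (vector [a $ 2, - a $ 1, 0], vector [b $ 2, - b $ 1, 0])"
    and "X' = (vector [0, a $ 3, 0], vector [0, b $ 3, 0])"
  define Y Y' where "Y = scaleC \<i> (H 3)" and "Y' = scaleC \<i> (H 1)"
  have i_i: "\<i> * (z * \<i>) = - z" for z
    by (simp add: complex_eq_iff)
  have "star W = - W" if "W \<in> {X, Y, X', Y'}" for W
    using that by (intro so31C_eqI)
      (auto simp: star_def X_def X'_def Y_def Y'_def scaleC_def H_def axis_def imaginary)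
  moreover have "Z = bracketC X Y + bracketC X' Y'"
    by (rule so31C_eqI) (simp_all add: bracketC_components X_def X'_def Y_def Y'_def scaleC_def H_def
        axis_def a_def b_def i_i)
  ultimately show ?case
    by blast
qed

section \<open>Existence and uniqueness of the functional\<close>

theorem proposition2p6:
  shows "\<exists>!\<psi>. schuermann_triple so31_bracket d10_scale d10_inner rho10 cocycle10 \<psi>"
proof (rule ex1I)
  show "schuermann_triple so31_bracket d10_scale d10_inner rho10 cocycle10 (\<lambda>X. 0)"
  proof
    fix X Y :: so31 and r :: real and v :: D10
    show "D10.anti_hermitian (rho10 X)"
      by (rule rho10_anti_hermitian)
    show "rho10 (X + Y) v = rho10 X v + rho10 Y v"
      "rho10 (r *\<^sub>R X) v = d10_scale (of_real r) (rho10 X v)"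
      "cocycle10 (X + Y) = cocycle10 X + cocycle10 Y"
      "cocycle10 (r *\<^sub>R X) = d10_scale (of_real r) (cocycle10 X)"
      by (rule poly_mapping_eqI;
          simp add: rho10_def rho10_C_def cocycle10_def cocycle10_C_def plus_so31.rep_eq scaleR_so31.rep_eq
            coord_plus_def coord_minus_def lookup_add lookup_minus scaleR_conv_of_real[where 'a = complex] field_simps)+
    show "rho10 (so31_bracket X Y) v = rho10 X (rho10 Y v) - rho10 Y (rho10 X v)"
      by (simp add: rho10_def so31_bracket.rep_eq rho10_C_bracket)
    show "cocycle10 (so31_bracket X Y) = rho10 X (cocycle10 Y) - rho10 Y (cocycle10 X)"
      by (simp add: rho10_def cocycle10_def so31_bracket.rep_eq cocycle10_C_bracket)
    show "0 = d10_inner (cocycle10 Y) (cocycle10 X) - d10_inner (cocycle10 X) (cocycle10 Y)"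
      by (simp add: inner_cocycle10_commute[of X Y])
  qed (simp_all add: linear_zero)
next
  fix \<psi>
  assume "schuermann_triple so31_bracket d10_scale d10_inner rho10 cocycle10 \<psi>"
  then interpret schuermann_triple so31_bracket d10_scale d10_inner rho10 cocycle10 \<psi> .
  show "\<psi> = (\<lambda>X. 0)"
  proof
    fix Z
    obtain X Y X' Y' where "Z = so31_bracket X Y + so31_bracket X' Y'"
      using so31_sum_of_two_brackets by blast
    then show "\<psi> Z = 0"
      using inner_cocycle10_commute by (simp add: linear_add[OF psi_linear] psi_bracket)
  qed
qed

end
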